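(* Let $a,b>0$ and let $E=\{(x,y)\in\mathbb{R}^2:\ x^2/a^2+y^2/b^2=1\}$, with center the origin $O$. For a 3-periodic billiard trajectory in $E$ with a chosen vertex $P$, let $P'=-P$ be the reflection of $P$ about $O$ (so $P'\in E$), let $T'$ be the excentral triangle of the trajectory, and let $Q_1$ and $Q_2$ be the two points at which the tangent line to $E$ at $P'$ intersects the sides of $T'$. Then, as the trajectory ranges over the family of all 3-periodic billiard trajectories in $E$, the locus of $Q_1$ (and likewise that of $Q_2$) is a circle centered at $O$.
   Context: Elliptic billiard: a particle moves in straight lines at constant speed inside $E$ and bounces elastically on $E$, i.e. at each bounce point the incoming and outgoing segments make equal angles with the normal to $E$. A 3-periodic trajectory (orbit) is a closed billiard trajectory with three bounce points, that is, a non-degenerate triangle $P_1P_2P_3$ inscribed in $E$ such that at each vertex the normal to $E$ bisects the interior angle of the triangle. For a fixed ellipse $E$ these triangles form a one-parameter family: every point of $E$ is a vertex of a member, and the chosen vertex $P$ moves continuously along all of $E$. The points $Q_1,Q_2$ are labeled consistently (continuously) along the family: each of them lies on the side of $T'$ passing through one of the two vertices of the trajectory other than $P$, $Q_1$ corresponding to the vertex that follows $P$ (in a fixed orientation of the family) and $Q_2$ to the vertex that precedes $P$. Excentral triangle of $P_1P_2P_3$: through each $P_i$ draw the line perpendicular to the interior angle bisector at $P_i$ (here, this is the tangent line to $E$ at $P_i$); the excentral triangle is the triangle bounded by these three lines. *)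

theory Defs
  imports "HOL-Analysis.Analysis"
begin

definition ellipse :: "real \<Rightarrow> real \<Rightarrow> (real^2) set" where
  "ellipse a b = {X. (X$1)\<^sup>2 / a\<^sup>2 + (X$2)\<^sup>2 / b\<^sup>2 = 1}"

(* Half the gradient of x^2/a^2 + y^2/b^2 at P: for P on the ellipse, an outward normal vector. *)
definition ellipse_normal :: "real \<Rightarrow> real \<Rightarrow> real^2 \<Rightarrow> real^2" where
  "ellipse_normal a b P = vector [P$1 / a\<^sup>2, P$2 / b\<^sup>2]"

definition ellipse_tangent :: "real \<Rightarrow> real \<Rightarrow> real^2 \<Rightarrow> (real^2) set" where
  "ellipse_tangent a b P = {X. (X - P) \<bullet> ellipse_normal a b P = 0}"

(* Unsigned angle in [0, pi]; only meaningful for nonzero vectors. *)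
definition vec_angle :: "real^2 \<Rightarrow> real^2 \<Rightarrow> real" where
  "vec_angle u v = arccos (u \<bullet> v / (norm u * norm v))"

(* The ray in direction d from the vertex P bisects the interior angle QPR. *)
definition bisects_angle :: "real^2 \<Rightarrow> real^2 \<Rightarrow> real^2 \<Rightarrow> real^2 \<Rightarrow> bool" where
  "bisects_angle d P Q R \<longleftrightarrow> d \<noteq> 0 \<and>
     vec_angle d (Q - P) = vec_angle (Q - P) (R - P) / 2 \<and>
     vec_angle d (R - P) = vec_angle (Q - P) (R - P) / 2"

(* The interior bisector at a vertex points into the ellipse, hence the inward normal. *)
definition billiard_orbit3 :: "real \<Rightarrow> real \<Rightarrow> real^2 \<Rightarrow> real^2 \<Rightarrow> real^2 \<Rightarrow> bool" where
  "billiard_orbit3 a b P1 P2 P3 \<longleftrightarrow>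
     P1 \<in> ellipse a b \<and> P2 \<in> ellipse a b \<and> P3 \<in> ellipse a b \<and>
     \<not> collinear {P1, P2, P3} \<and>
     bisects_angle (- ellipse_normal a b P1) P1 P2 P3 \<and>
     bisects_angle (- ellipse_normal a b P2) P2 P3 P1 \<and>
     bisects_angle (- ellipse_normal a b P3) P3 P1 P2"

(* 1 if P1, P2, P3 run counterclockwise, -1 if clockwise. *)
definition orientation :: "real^2 \<Rightarrow> real^2 \<Rightarrow> real^2 \<Rightarrow> real" where
  "orientation P1 P2 P3 = sgn (det (vector [P2 - P1, P3 - P1] :: real^2^2))"

(* The line through P perpendicular to the interior bisector of the angle QPR. *)
definition excentral_line :: "real^2 \<Rightarrow> real^2 \<Rightarrow> real^2 \<Rightarrow> (real^2) set" where
  "excentral_line P Q R = {X. \<exists>d. bisects_angle d P Q R \<and> (X - P) \<bullet> d = 0}"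

(* A1 A2 A3 is the excentral triangle of P1 P2 P3; the vertex Ai is opposite the side through Pi. *)
definition excentral_triangle ::
  "real^2 \<Rightarrow> real^2 \<Rightarrow> real^2 \<Rightarrow> real^2 \<Rightarrow> real^2 \<Rightarrow> real^2 \<Rightarrow> bool" where
  "excentral_triangle P1 P2 P3 A1 A2 A3 \<longleftrightarrow>
     excentral_line P2 P3 P1 \<inter> excentral_line P3 P1 P2 = {A1} \<and>
     excentral_line P3 P1 P2 \<inter> excentral_line P1 P2 P3 = {A2} \<and>
     excentral_line P1 P2 P3 \<inter> excentral_line P2 P3 P1 = {A3}"

(* The chosen vertex is P1. Requiring all orbits to have the same orientation s labels the other
   two vertices consistently along the family: P2 follows P1 and P3 precedes it. *)
definition locus_Q1 :: "real \<Rightarrow> real \<Rightarrow> real \<Rightarrow> (real^2) set" where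
  "locus_Q1 a b s = {Q. \<exists>P1 P2 P3 A1 A2 A3.
     billiard_orbit3 a b P1 P2 P3 \<and> orientation P1 P2 P3 = s \<and>
     excentral_triangle P1 P2 P3 A1 A2 A3 \<and>
     Q \<in> ellipse_tangent a b (- P1) \<inter> closed_segment A3 A1}"

definition locus_Q2 :: "real \<Rightarrow> real \<Rightarrow> real \<Rightarrow> (real^2) set" where
  "locus_Q2 a b s = {Q. \<exists>P1 P2 P3 A1 A2 A3.
     billiard_orbit3 a b P1 P2 P3 \<and> orientation P1 P2 P3 = s \<and>
     excentral_triangle P1 P2 P3 A1 A2 A3 \<and>
     Q \<in> ellipse_tangent a b (- P1) \<inter> closed_segment A1 A2}"

end

theory Submission
  imports Defs
begin

text \<open>
  Write the vertices as \<open>P\<^sub>i = (a c\<^sub>i, b s\<^sub>i)\<close> with \<open>p\<^sub>i = (c\<^sub>i, s\<^sub>i)\<close> a unit vector. The reflection law at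
  \<open>P\<^sub>i\<close> says that Joachimsthal's quantity \<open>J = (1 - p\<^sub>i \<bullet> p\<^sub>j) / \<bar>P\<^sub>i - P\<^sub>j\<bar>\<close> is the same for both sides
  at \<open>P\<^sub>i\<close>; so all sides share one \<open>J\<close>, and with \<open>R = 1 / J\<^sup>2\<close> this becomes the bilinear condition
  \<open>\<alpha> c\<^sub>i c\<^sub>j + \<beta> s\<^sub>i s\<^sub>j = \<gamma>\<close>, where \<open>\<alpha> = R - a\<^sup>2 + b\<^sup>2\<close>, \<open>\<beta> = R + a\<^sup>2 - b\<^sup>2\<close>, \<open>\<gamma> = R - a\<^sup>2 - b\<^sup>2\<close>.

  The tangents at \<open>P\<^sub>2\<close> and \<open>- P\<^sub>1\<close> meet in \<open>Q = (P\<^sub>2 - P\<^sub>1) / (1 - p\<^sub>1 \<bullet> p\<^sub>2)\<close>, so \<open>\<bar>Q\<bar>\<^sup>2 = 1 / J\<^sup>2 = R\<close>.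
  A triangle of pairwise conjugate points exists only if \<open>\<alpha>\<beta> + \<gamma>(\<alpha> + \<beta>) = 0\<close> (Cayley's condition),
  which has exactly one positive solution \<open>R\<close>. Conversely, for a point \<open>Q\<close> with \<open>\<bar>Q\<bar>\<^sup>2 = R\<close> the two
  points of tangency from \<open>Q\<close> are \<open>P\<^sub>2\<close> and \<open>- P\<^sub>1\<close> of an orbit, which closes up by Cayley's condition.
  The other assignment of the tangency points gives the orbit \<open>(- P\<^sub>2, - P\<^sub>1, - P\<^sub>3)\<close> of the opposite
  orientation, so both orientations sweep out the whole circle.
\<close>

section \<open>Points of the ellipse\<close>

definition ell_pt :: "real \<Rightarrow> real \<Rightarrow> real \<Rightarrow> real \<Rightarrow> real^2" where
  "ell_pt a b c s = vector [a * c, b * s]"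

text \<open>The points \<open>(c, s)\<close> and \<open>(c', s')\<close> are conjugate with respect to the conic
  \<open>\<alpha> x\<^sup>2 + \<beta> y\<^sup>2 = \<gamma>\<close>.\<close>

definition conj_chord :: "real \<Rightarrow> real \<Rightarrow> real \<Rightarrow> real \<Rightarrow> real \<Rightarrow> real \<Rightarrow> real \<Rightarrow> bool" where
  "conj_chord \<alpha> \<beta> \<gamma> c s c' s' \<longleftrightarrow> \<alpha> * (c * c') + \<beta> * (s * s') = \<gamma>"

lemma ell_pt_nth [simp]: "ell_pt a b c s $ 1 = a * c" "ell_pt a b c s $ 2 = b * s"
  by (simp_all add: ell_pt_def)

lemma uminus_ell_pt: "- ell_pt a b c s = ell_pt a b (- c) (- s)"
  by (simp add: vec_eq_iff forall_2)

lemma ell_pt_eq_iff: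
  assumes "a > 0" "b > 0"
  shows "ell_pt a b c s = ell_pt a b c' s' \<longleftrightarrow> (c, s) = (c', s')"
  using assms by (auto simp: vec_eq_iff forall_2)

lemma ell_pt_surj:
  assumes "a > 0" "b > 0"
  obtains c s where "X = ell_pt a b c s"
proof
  show "X = ell_pt a b (X$1 / a) (X$2 / b)"
    using assms by (simp add: vec_eq_iff forall_2)
qed

lemma ell_pt_in_ellipse_iff:
  assumes "a > 0" "b > 0"
  shows "ell_pt a b c s \<in> ellipse a b \<longleftrightarrow> c\<^sup>2 + s\<^sup>2 = 1"
  using assms by (simp add: ellipse_def power_mult_distrib)

lemma inner_real_2: "(x::real^2) \<bullet> y = x$1 * y$1 + x$2 * y$2"
  by (simp add: inner_vec_def sum_2)

lemma norm_ell_pt: "(norm (ell_pt a b c s))\<^sup>2 = a\<^sup>2 * c\<^sup>2 + b\<^sup>2 * s\<^sup>2"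
  unfolding power2_norm_eq_inner by (simp add: inner_real_2 power2_eq_square algebra_simps)

lemma diff_ell_pt: "ell_pt a b c s - ell_pt a b c' s' = ell_pt a b (c - c') (s - s')"
  by (simp add: vec_eq_iff forall_2 algebra_simps)

lemma scale_ell_pt: "r *\<^sub>R ell_pt a b c s = ell_pt a b (r * c) (r * s)"
  by (simp add: vec_eq_iff forall_2 algebra_simps)

lemma add_ell_pt: "ell_pt a b c s + ell_pt a b c' s' = ell_pt a b (c + c') (s + s')"
  by (simp add: vec_eq_iff forall_2 algebra_simps)

lemma inner_ell_pt_normal:
  assumes "a > 0" "b > 0"
  shows "ell_pt a b x y \<bullet> ellipse_normal a b (ell_pt a b c s) = x * c + y * s"
  using assms by (simp add: inner_real_2 ellipse_normal_def power2_eq_square)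

lemma ell_pt_in_tangent_iff:
  assumes "a > 0" "b > 0" "c\<^sup>2 + s\<^sup>2 = 1"
  shows "ell_pt a b x y \<in> ellipse_tangent a b (ell_pt a b c s) \<longleftrightarrow> x * c + y * s = 1"
  using assms
  by (simp add: ellipse_tangent_def inner_diff_left inner_ell_pt_normal flip: power2_eq_square)

lemma unit_inner_less_1:
  fixes c s c' s' :: real
  assumes "c\<^sup>2 + s\<^sup>2 = 1" "c'\<^sup>2 + s'\<^sup>2 = 1" "(c, s) \<noteq> (c', s')"
  shows "c * c' + s * s' < 1"
proof -
  have "0 < (c - c')\<^sup>2 + (s - s')\<^sup>2"
    using assms(3) by (auto simp: sum_power2_gt_zero_iff)
  also have "\<dots> = 2 - 2 * (c * c' + s * s')"
    using assms(1,2) by (simp add: power2_eq_square algebra_simps)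
  finally show ?thesis by simp
qed

text \<open>The squared determinant is twice the product of the three numbers
  \<open>1 - p\<^sub>i \<bullet> p\<^sub>j\<close>, each of which is positive for distinct unit
  vectors.\<close>

lemma unit_det_zero_imp_eq:
  fixes c1 s1 c2 s2 c3 s3 :: real
  assumes "c1\<^sup>2 + s1\<^sup>2 = 1" "c2\<^sup>2 + s2\<^sup>2 = 1" "c3\<^sup>2 + s3\<^sup>2 = 1"
    and "(c2 - c1) * (s3 - s1) = (s2 - s1) * (c3 - c1)"
  shows "\<not> distinct [(c1, s1), (c2, s2), (c3, s3)]"
proof
  assume d: "distinct [(c1, s1), (c2, s2), (c3, s3)]"
  have "(1 - (c1 * c2 + s1 * s2)) * (1 - (c1 * c3 + s1 * s3)) * (1 - (c2 * c3 + s2 * s3)) * 2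
      = ((c2 - c1) * (s3 - s1) - (s2 - s1) * (c3 - c1))\<^sup>2"
    using assms(1-3) by algebra
  moreover have "c1 * c2 + s1 * s2 < 1" "c1 * c3 + s1 * s3 < 1" "c2 * c3 + s2 * s3 < 1"
    using d assms by (auto intro!: unit_inner_less_1)
  ultimately show False using assms(4) by simp
qed

text \<open>On the unit circle both \<open>(c - c')\<^sup>2\<close> and
  \<open>(s - s')\<^sup>2\<close> are divisible by \<open>k = 1 - (c * c' + s * s')\<close>.
  Cancelling one factor \<open>k\<close> turns the quadratic length equation into a bilinear
  one.\<close>

lemma chord_iff:
  fixes c s c' s' :: real
  assumes "c\<^sup>2 + s\<^sup>2 = 1" "c'\<^sup>2 + s'\<^sup>2 = 1" "(c, s) \<noteq> (c', s')"
  shows "R * (1 - (c * c' + s * s'))\<^sup>2 = a\<^sup>2 * (c - c')\<^sup>2 + b\<^sup>2 * (s - s')\<^sup>2 \<longleftrightarrow>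
    conj_chord (R - a\<^sup>2 + b\<^sup>2) (R + a\<^sup>2 - b\<^sup>2) (R - a\<^sup>2 - b\<^sup>2) c s c' s'"
proof -
  define k where "k = 1 - (c * c' + s * s')"
  have k: "k \<noteq> 0" using unit_inner_less_1[OF assms] by (simp add: k_def)
  have 1: "(c - c')\<^sup>2 = k * (1 - c * c' + s * s')" "(s - s')\<^sup>2 = k * (1 + c * c' - s * s')"
    unfolding k_def using assms(1,2) by algebra+
  have "R * k\<^sup>2 = a\<^sup>2 * (c - c')\<^sup>2 + b\<^sup>2 * (s - s')\<^sup>2 \<longleftrightarrow>
      k * (R * k) = k * (a\<^sup>2 * (1 - c * c' + s * s') + b\<^sup>2 * (1 + c * c' - s * s'))"
    unfolding 1 by (simp add: power2_eq_square algebra_simps)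
  also have "\<dots> \<longleftrightarrow> R * k = a\<^sup>2 * (1 - c * c' + s * s') + b\<^sup>2 * (1 + c * c' - s * s')"
    using k by simp
  finally show ?thesis
    unfolding conj_chord_def k_def by (simp add: algebra_simps) linarith
qed

section \<open>Triangles of conjugate points and Cayley's condition\<close>

text \<open>\<open>p\<^sub>2\<close> and \<open>p\<^sub>3\<close> are the intersections of the unit circle with the line \<open>m x + n y = \<gamma>\<close>, the
  polar of \<open>p\<^sub>1\<close>; hence they are mirror images in the direction \<open>(m, n)\<close>.\<close>

lemma conj_triangle_vertex:
  fixes c1 s1 c2 s2 c3 s3 :: real
  assumes "c2\<^sup>2 + s2\<^sup>2 = 1" "c3\<^sup>2 + s3\<^sup>2 = 1" "(c2, s2) \<noteq> (c3, s3)"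
    and "conj_chord \<alpha> \<beta> \<gamma> c1 s1 c2 s2" "conj_chord \<alpha> \<beta> \<gamma> c1 s1 c3 s3"
    and "conj_chord \<alpha> \<beta> \<gamma> c2 s2 c3 s3"
  shows "\<alpha>\<^sup>2 * (\<beta> + \<gamma>) * c1\<^sup>2 + \<beta>\<^sup>2 * (\<alpha> + \<gamma>) * s1\<^sup>2 = \<gamma>\<^sup>2 * (\<alpha> + \<beta>)"
proof -
  define m n where "m = \<alpha> * c1" and "n = \<beta> * s1"
  define N where "N = m\<^sup>2 + n\<^sup>2"
  define h2 h3 where "h2 = m * s2 - n * c2" and "h3 = m * s3 - n * c3"
  have l: "m * c2 + n * s2 = \<gamma>" "m * c3 + n * s3 = \<gamma>"
    using assms(4,5) by (simp_all add: conj_chord_def m_def n_def algebra_simps)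
  have "(m * y - n * x)\<^sup>2 + (m * x + n * y)\<^sup>2 = (m\<^sup>2 + n\<^sup>2) * (x\<^sup>2 + y\<^sup>2)" for x y
    by algebra
  from this[where x = c2 and y = s2] this[where x = c3 and y = s3]
  have h: "h2\<^sup>2 = N - \<gamma>\<^sup>2" "h3\<^sup>2 = N - \<gamma>\<^sup>2"
    unfolding h2_def h3_def N_def l assms(1,2) by simp_all
  \<comment> \<open>Decomposition in the orthogonal basis (m, n), (-n, m): the component \<gamma> is
    common to both points, so they can differ only in \<open>h2\<close> and
    \<open>h3\<close>.\<close>
  have p: "N * c2 = \<gamma> * m - h2 * n" "N * s2 = \<gamma> * n + h2 * m"
    unfolding l(1)[symmetric] h2_def N_def by algebra+
  have p': "N * c3 = \<gamma> * m - h3 * n" "N * s3 = \<gamma> * n + h3 * m"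
    unfolding l(2)[symmetric] h3_def N_def by algebra+
  show ?thesis
  proof (cases "N = 0")
    \<comment> \<open>Here the polar degenerates, but \<gamma> vanishes as well and every term of
      the claim is zero.\<close>
    case True
    then have z: "m = 0" "n = 0" by (auto simp: N_def sum_power2_eq_zero_iff)
    then have "\<gamma> = 0" "\<alpha> * c1 = 0" "\<beta> * s1 = 0" using l by (auto simp: m_def n_def)
    then show ?thesis by algebra
  next
    case False
    have "h2 \<noteq> h3"
    proof
      assume "h2 = h3"
      with p p' have "N * c2 = N * c3" "N * s2 = N * s3" by simp_all
      with False assms(3) show False by simp
    qed
    with h have h3: "h3 = - h2" by (metis power2_eq_iff)
    have "N * (N * \<gamma>) = \<alpha> * ((N * c2) * (N * c3)) + \<beta> * ((N * s2) * (N * s3))"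
      unfolding assms(6)[unfolded conj_chord_def, symmetric] by algebra
    also have "\<dots> = N * (\<alpha> * (\<gamma>\<^sup>2 - n\<^sup>2) + \<beta> * (\<gamma>\<^sup>2 - m\<^sup>2))"
      unfolding p p' h3 using h(1) N_def by algebra
    finally have "N * \<gamma> = \<alpha> * (\<gamma>\<^sup>2 - n\<^sup>2) + \<beta> * (\<gamma>\<^sup>2 - m\<^sup>2)"
      using False by simp
    then show ?thesis unfolding N_def m_def n_def by algebra
  qed
qed

lemma conj_triangle_cayley:
  fixes c1 s1 c2 s2 c3 s3 :: real
  assumes u: "c1\<^sup>2 + s1\<^sup>2 = 1" "c2\<^sup>2 + s2\<^sup>2 = 1" "c3\<^sup>2 + s3\<^sup>2 = 1"
    and d: "distinct [(c1, s1), (c2, s2), (c3, s3)]"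
    and n: "(c1, s1) \<noteq> (- c2, - s2)" "(c2, s2) \<noteq> (- c3, - s3)" "(c3, s3) \<noteq> (- c1, - s1)"
    and c: "conj_chord \<alpha> \<beta> \<gamma> c1 s1 c2 s2" "conj_chord \<alpha> \<beta> \<gamma> c2 s2 c3 s3"
      "conj_chord \<alpha> \<beta> \<gamma> c3 s3 c1 s1"
    and pos: "\<alpha> + \<beta> > 0"
  shows "\<alpha> * \<beta> + \<gamma> * (\<alpha> + \<beta>) = 0"
proof -
  have comm: "conj_chord \<alpha> \<beta> \<gamma> c s c' s'" if "conj_chord \<alpha> \<beta> \<gamma> c' s' c s" for c s c' s'
    using that by (simp add: conj_chord_def mult.commute)
  \<comment> \<open>By \<open>conj_triangle_vertex\<close> all three vertices lie on the one conic
    \<open>X x\<^sup>2 + Y y\<^sup>2 = Z\<close>.\<close>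
  define X Y Z where "X = \<alpha>\<^sup>2 * (\<beta> + \<gamma>)" and "Y = \<beta>\<^sup>2 * (\<alpha> + \<gamma>)" and "Z = \<gamma>\<^sup>2 * (\<alpha> + \<beta>)"
  have v: "X * c1\<^sup>2 + Y * s1\<^sup>2 = Z" "X * c2\<^sup>2 + Y * s2\<^sup>2 = Z" "X * c3\<^sup>2 + Y * s3\<^sup>2 = Z"
    unfolding X_def Y_def Z_def
    using d u c comm[OF c(1)] comm[OF c(2)] comm[OF c(3)]
    by (auto intro: conj_triangle_vertex[of c2 s2 c3 s3 _ _ _ c1 s1]
        conj_triangle_vertex[of c3 s3 c1 s1 _ _ _ c2 s2]
        conj_triangle_vertex[of c1 s1 c2 s2 _ _ _ c3 s3])
  \<comment> \<open>Otherwise the three points would have equal \<open>c\<^sup>2\<close> and equal \<open>s\<^sup>2\<close>, hence lie on a rectangle,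
    and two of them would be antipodal.\<close>
  have "X = Y"
  proof (rule ccontr)
    assume "X \<noteq> Y"
    have s: "s1\<^sup>2 = 1 - c1\<^sup>2" "s2\<^sup>2 = 1 - c2\<^sup>2" "s3\<^sup>2 = 1 - c3\<^sup>2"
      using u by simp_all
    have "(X - Y) * (c1\<^sup>2 - c2\<^sup>2) = 0" "(X - Y) * (c2\<^sup>2 - c3\<^sup>2) = 0"
      using v s by (simp_all add: algebra_simps)
    with \<open>X \<noteq> Y\<close> have "c1\<^sup>2 = c2\<^sup>2" "c2\<^sup>2 = c3\<^sup>2" by simp_all
    moreover from this u have "s1\<^sup>2 = s2\<^sup>2" "s2\<^sup>2 = s3\<^sup>2" by simp_all
    ultimately show False using d n by (auto simp: power2_eq_iff)
  qed
  then have f: "(\<alpha> - \<beta>) * (\<alpha> * \<beta> + \<gamma> * (\<alpha> + \<beta>)) = 0"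
    unfolding X_def Y_def by algebra
  show ?thesis
  proof (cases "\<alpha> = \<beta>")
    \<comment> \<open>For \<alpha> = \<beta> the factorization of \<open>X - Y\<close> gives
      nothing, so \<open>X = Z\<close> is used instead. Its root \<alpha> = \<gamma> would make
      \<open>p\<^sub>1\<close> and \<open>p\<^sub>2\<close> coincide.\<close>
    case True
    have "X * (c1\<^sup>2 + s1\<^sup>2) = Z" using v(1) \<open>X = Y\<close> by (simp add: algebra_simps)
    then have "X = Z" using u(1) by simp
    then have "\<alpha> * ((\<alpha> - \<gamma>) * (\<alpha> + 2 * \<gamma>)) = 0"
      using True unfolding X_def Z_def by algebra
    moreover have "\<alpha> > 0" using True pos by simp
    moreover have "\<alpha> \<noteq> \<gamma>"
    proof
      assume "\<alpha> = \<gamma>"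
      with c(1) True have "\<alpha> * (c1 * c2 + s1 * s2) = \<alpha>" by (simp add: conj_chord_def algebra_simps)
      with \<open>\<alpha> > 0\<close> have "c1 * c2 + s1 * s2 = 1" by simp
      with unit_inner_less_1[OF u(1,2)] d show False by simp
    qed
    ultimately have "\<gamma> = - \<beta> / 2" using True by simp
    with True show ?thesis by (simp add: field_simps)
  qed (use f in simp)
qed

text \<open>Converse of Cayley's condition: the third vertex is the second point in which the polar
  of \<open>p\<^sub>1\<close> meets the unit circle. The sign conditions guarantee that the polar is
  a proper secant.\<close>

lemma conj_triangle_close:
  fixes c1 s1 c2 s2 :: real
  assumes cay: "\<alpha> * \<beta> + \<gamma> * (\<alpha> + \<beta>) = 0"
    and u: "c1\<^sup>2 + s1\<^sup>2 = 1" "c2\<^sup>2 + s2\<^sup>2 = 1" and c: "conj_chord \<alpha> \<beta> \<gamma> c1 s1 c2 s2"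
    and pos: "\<gamma> < 0" "\<alpha> + \<gamma> > 0" "\<beta> + \<gamma> > 0"
  obtains c3 s3 where "c3\<^sup>2 + s3\<^sup>2 = 1" "(c2, s2) \<noteq> (c3, s3)"
    "conj_chord \<alpha> \<beta> \<gamma> c2 s2 c3 s3" "conj_chord \<alpha> \<beta> \<gamma> c3 s3 c1 s1"
proof -
  define m n where "m = \<alpha> * c1" and "n = \<beta> * s1"
  define N where "N = m\<^sup>2 + n\<^sup>2"
  have l: "m * c2 + n * s2 = \<gamma>"
    using c by (simp add: conj_chord_def m_def n_def algebra_simps)
  have "N - \<gamma>\<^sup>2 = (\<alpha>\<^sup>2 - \<gamma>\<^sup>2) * c1\<^sup>2 + (\<beta>\<^sup>2 - \<gamma>\<^sup>2) * s1\<^sup>2"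
    unfolding N_def m_def n_def using u(1) by algebra
  moreover have "\<alpha>\<^sup>2 - \<gamma>\<^sup>2 > 0" "\<beta>\<^sup>2 - \<gamma>\<^sup>2 > 0"
    using pos by (simp_all add: power2_eq_square square_diff_square_factored)
  moreover have "c1 \<noteq> 0 \<or> s1 \<noteq> 0" using u(1) by auto
  \<comment> \<open>The polar has distance less than 1 from the origin.\<close>
  ultimately have N: "N > \<gamma>\<^sup>2"
    by (smt (verit) mult_nonneg_nonneg mult_pos_pos zero_less_power2 zero_le_power2)
  then have N0: "N > 0" by (smt (verit) zero_le_power2)
  \<comment> \<open>The foot of the perpendicular from the origin to the polar is
    \<open>\<gamma> (m, n) / N\<close>; \<open>p\<^sub>2\<close> is reflected in it.\<close>
  define c3 s3 where "c3 = 2 * \<gamma> * m / N - c2" and "s3 = 2 * \<gamma> * n / N - s2"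
  have p: "N * c3 = 2 * \<gamma> * m - N * c2" "N * s3 = 2 * \<gamma> * n - N * s2"
    using N0 by (simp_all add: c3_def s3_def field_simps)
  show ?thesis
  proof
    have "N * N * (c3\<^sup>2 + s3\<^sup>2) = N * N * 1" using p l u N_def by algebra
    then show "c3\<^sup>2 + s3\<^sup>2 = 1" using N0 by simp
    have "N * (m * c3 + n * s3) = N * \<gamma>" using p l N_def by algebra
    then have "m * c3 + n * s3 = \<gamma>" using N0 by simp
    then show "conj_chord \<alpha> \<beta> \<gamma> c3 s3 c1 s1"
      by (simp add: conj_chord_def m_def n_def algebra_simps)
    show "(c2, s2) \<noteq> (c3, s3)"
    proof
      assume "(c2, s2) = (c3, s3)"
      with p have "N * c2 = \<gamma> * m" "N * s2 = \<gamma> * n" by simp_all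
      then have "N * N = N * \<gamma>\<^sup>2" using u(2) N_def by algebra
      with N N0 show False by simp
    qed
    define h where "h = m * s2 - n * c2"
    have "(m * s2 - n * c2)\<^sup>2 + (m * c2 + n * s2)\<^sup>2 = (m\<^sup>2 + n\<^sup>2) * (c2\<^sup>2 + s2\<^sup>2)"
      by algebra
    then have h: "h\<^sup>2 = N - \<gamma>\<^sup>2" unfolding h_def N_def l u(2) by simp
    have q: "N * c2 = \<gamma> * m - h * n" "N * s2 = \<gamma> * n + h * m"
      unfolding l[symmetric] h_def N_def by algebra+
    then have q': "N * c3 = \<gamma> * m + h * n" "N * s3 = \<gamma> * n - h * m" using p by simp_all
    \<comment> \<open>Cayley's condition makes all three coefficients in
      \<open>conj_triangle_vertex\<close> equal to -\<alpha>\<beta>\<gamma>, so its equation holds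
      at every unit vector.\<close>
    have "N * \<gamma> = \<alpha> * (\<gamma>\<^sup>2 - n\<^sup>2) + \<beta> * (\<gamma>\<^sup>2 - m\<^sup>2)"
      unfolding N_def m_def n_def using cay u(1) by algebra
    moreover have "\<alpha> * ((N * c2) * (N * c3)) + \<beta> * ((N * s2) * (N * s3))
      = N * (\<alpha> * (\<gamma>\<^sup>2 - n\<^sup>2) + \<beta> * (\<gamma>\<^sup>2 - m\<^sup>2))"
      unfolding q q' using h N_def by algebra
    ultimately have "N * N * (\<alpha> * (c2 * c3) + \<beta> * (s2 * s3)) = N * N * \<gamma>"
      by algebra
    then show "conj_chord \<alpha> \<beta> \<gamma> c2 s2 c3 s3" using N0 by (simp add: conj_chord_def)
  qed
qed

text \<open>Parallel unit vectors are equal or opposite, so conjugacy would read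
  \<open>\<alpha> * c\<^sup>2 + \<beta> * s\<^sup>2 = \<gamma>\<close> up to a sign on the left. The
  sign conditions make that form larger than -\<gamma> > 0.\<close>

lemma conj_chord_indep:
  fixes c s c' s' :: real
  assumes u: "c\<^sup>2 + s\<^sup>2 = 1" "c'\<^sup>2 + s'\<^sup>2 = 1" and c: "conj_chord \<alpha> \<beta> \<gamma> c s c' s'"
    and pos: "\<gamma> < 0" "\<alpha> + \<gamma> > 0" "\<beta> + \<gamma> > 0"
  shows "c * s' \<noteq> s * c'"
proof
  assume D: "c * s' = s * c'"
  have "(c * c' + s * s')\<^sup>2 + (c * s' - s * c')\<^sup>2 = (c\<^sup>2 + s\<^sup>2) * (c'\<^sup>2 + s'\<^sup>2)" by algebra
  then have p: "(c * c' + s * s')\<^sup>2 = 1" using D u by simp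
  define p where "p = c * c' + s * s'"
  have "c' = p * c" "s' = p * s" using D u(1) unfolding p_def by algebra+
  with c have g: "p * (\<alpha> * c\<^sup>2 + \<beta> * s\<^sup>2) = \<gamma>"
    by (simp add: conj_chord_def power2_eq_square algebra_simps)
  have "\<alpha> * c\<^sup>2 + \<beta> * s\<^sup>2 + \<gamma> = (\<alpha> + \<gamma>) * c\<^sup>2 + (\<beta> + \<gamma>) * s\<^sup>2"
    using u(1) by algebra
  moreover have "c \<noteq> 0 \<or> s \<noteq> 0" using u(1) by auto
  ultimately have "\<alpha> * c\<^sup>2 + \<beta> * s\<^sup>2 + \<gamma> > 0"
    using pos by (smt (verit) mult_nonneg_nonneg mult_pos_pos zero_less_power2 zero_le_power2)
  moreover have "p = 1 \<or> p = -1" using p by (simp add: p_def power2_eq_1_iff)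
  ultimately show False using g pos(1) by auto
qed

lemma linear_2_unique:
  fixes x y x' y' :: real
  assumes "c * s' \<noteq> s * c'" "x * c + y * s = x' * c + y' * s" "x * c' + y * s' = x' * c' + y' * s'"
  shows "x = x' \<and> y = y'"
proof -
  have "(c * s' - s * c') * (x - x') = 0" "(c * s' - s * c') * (y - y') = 0"
    using assms(2,3) by algebra+
  with assms(1) show ?thesis by simp
qed

section \<open>Angle bisectors in the plane\<close>

lemma collinear_real_2:
  fixes P Q R :: "real^2"
  shows "collinear {P, Q, R} \<longleftrightarrow> (Q - P)$1 * (R - P)$2 = (Q - P)$2 * (R - P)$1"
proof -
  have aux: "collinear {0, x, y} \<longleftrightarrow> x$1 * y$2 = x$2 * y$1" for x y :: "real^2"
  proof (cases "x = 0")
    case False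
    have "\<exists>c. y = c *\<^sub>R x" if e: "x$1 * y$2 = x$2 * y$1"
    proof (cases "x$1 = 0")
      case True
      with False have "x$2 \<noteq> 0" by (auto simp: vec_eq_iff forall_2)
      with True e show ?thesis
        by (intro exI[of _ "y$2 / x$2"]) (auto simp: vec_eq_iff forall_2)
    next
      case F: False
      with e show ?thesis
        by (intro exI[of _ "y$1 / x$1"]) (auto simp: vec_eq_iff forall_2 field_simps)
    qed
    then show ?thesis using False by (auto simp: collinear_lemma)
  qed simp
  \<comment> \<open>\<open>collinear_3\<close> takes the middle point as the origin, hence the
    exchange.\<close>
  have "collinear {P, Q, R} \<longleftrightarrow> collinear {Q, P, R}" by (simp add: insert_commute)
  also have "\<dots> \<longleftrightarrow> collinear {0, Q - P, R - P}"
    by (subst collinear_3) (auto simp: NO_MATCH_def)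
  finally show ?thesis by (simp add: aux)
qed

lemma sgn_neq_if_not_collinear:
  fixes P Q R :: "real^2"
  assumes "\<not> collinear {P, Q, R}"
  shows "sgn (Q - P) \<noteq> sgn (R - P)"
proof
  define e where "e = sgn (R - P)"
  assume "sgn (Q - P) = sgn (R - P)"
  moreover have "x = norm x *\<^sub>R sgn x" for x :: "real^2"
    by (cases "x = 0") (auto simp: sgn_div_norm)
  ultimately obtain k l where "Q - P = k *\<^sub>R e" "R - P = l *\<^sub>R e"
    unfolding e_def by metis
  then have "(Q - P)$1 * (R - P)$2 = (Q - P)$2 * (R - P)$1"
    by simp
  with assms show False by (simp add: collinear_real_2)
qed

lemma vec_angle_eq_arccos_sgn: "vec_angle u v = arccos (sgn u \<bullet> sgn v)"
  by (simp add: vec_angle_def sgn_div_norm divide_inverse mult_ac)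

lemma abs_inner_sgn_le_1: "\<bar>sgn u \<bullet> sgn v\<bar> \<le> 1" for u v :: "real^2"
proof -
  have "norm (sgn u) * norm (sgn v) \<le> 1" by (simp add: norm_sgn)
  with Cauchy_Schwarz_ineq2[of "sgn u" "sgn v"] show ?thesis by linarith
qed

text \<open>Injectivity of arccos turns the equality of the two angles into a condition linear in
  \<open>d\<close>.\<close>

lemma bisects_angle_imp:
  assumes "bisects_angle d P Q R"
  shows "d \<bullet> sgn (Q - P) = d \<bullet> sgn (R - P)"
proof -
  have "arccos (sgn d \<bullet> sgn (Q - P)) = arccos (sgn d \<bullet> sgn (R - P))" "d \<noteq> 0"
    using assms by (simp_all add: bisects_angle_def vec_angle_eq_arccos_sgn)
  then have "sgn d \<bullet> sgn (Q - P) = sgn d \<bullet> sgn (R - P)"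
    by (simp add: arccos_eq_iff abs_inner_sgn_le_1)
  with \<open>d \<noteq> 0\<close> show ?thesis by (simp add: sgn_div_norm[of d])
qed

lemma orthogonal_2_parallel:
  fixes d e f :: "real^2"
  assumes "e \<noteq> 0" "d \<bullet> e = 0" "f \<bullet> e = 0"
  shows "d$1 * f$2 = d$2 * f$1"
proof -
  have "e$1 * (d$1 * f$2 - d$2 * f$1) = 0" "e$2 * (d$1 * f$2 - d$2 * f$1) = 0"
    using assms(2,3) unfolding inner_real_2 by algebra+
  moreover have "e$1 \<noteq> 0 \<or> e$2 \<noteq> 0" using assms(1) by (auto simp: vec_eq_iff forall_2)
  ultimately show ?thesis by auto
qed

text \<open>Both \<open>d\<close> and \<open>v + w\<close> are orthogonal to \<open>v - w\<close>,
  hence parallel. This is the equality case of Cauchy-Schwarz, and the half-angle formula for cosine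
  does the rest.\<close>

lemma vec_angle_half:
  fixes d v w :: "real^2"
  assumes "norm v = 1" "norm w = 1" "v \<noteq> w" "d \<bullet> v = d \<bullet> w" "d \<bullet> v > 0"
  shows "vec_angle d v = vec_angle v w / 2"
proof -
  define x where "x = v \<bullet> w"
  have "\<bar>x\<bar> \<le> 1" using Cauchy_Schwarz_ineq2[of v w] assms by (simp add: x_def)
  then have arccos: "0 \<le> arccos x" "arccos x \<le> pi" "- pi \<le> arccos x"
    using arccos_lbound[of x] arccos_ubound[of x] pi_ge_zero by (auto intro: order_trans[of _ 0])
  have d: "d \<noteq> 0" using assms(5) by auto
  have vw: "v \<bullet> v = 1" "w \<bullet> w = 1" using assms(1,2) by (simp_all add: dot_square_norm)
  have "(v + w) \<bullet> (v - w) = 0"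
    unfolding inner_add_left inner_diff_right vw by (simp add: inner_commute)
  with assms have "d$1 * (v + w)$2 = d$2 * (v + w)$1"
    by (intro orthogonal_2_parallel[of "v - w"]) (auto simp: inner_diff_right)
  then have "(d \<bullet> (v + w))\<^sup>2 = (d \<bullet> d) * ((v + w) \<bullet> (v + w))"
    unfolding inner_real_2 by algebra
  moreover have "d \<bullet> (v + w) = 2 * (d \<bullet> v)" using assms(4) by (simp add: inner_add_right)
  moreover have "(v + w) \<bullet> (v + w) = 2 + 2 * x"
    using vw by (simp add: x_def inner_add_left inner_add_right inner_commute)
  ultimately have "(d \<bullet> v / norm d)\<^sup>2 = (1 + x) / 2"
    using d by (simp add: power_mult_distrib power_divide dot_square_norm field_simps)
  also have "\<dots> = (cos (arccos x / 2))\<^sup>2"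
    using \<open>\<bar>x\<bar> \<le> 1\<close> cos_double_cos[of "arccos x / 2"] by simp
  finally have "d \<bullet> v / norm d = cos (arccos x / 2)"
    using assms(5) arccos
    by (subst (asm) power2_eq_iff_nonneg) (auto intro!: cos_ge_zero)
  then show ?thesis
    using assms(1,2) arccos
    by (simp add: vec_angle_def x_def[symmetric] arccos_cos)
qed

text \<open>The equation fixes the bisector line; positivity selects the ray into the interior
  angle.\<close>

lemma bisects_angleI:
  assumes "\<not> collinear {P, Q, R}"
    and "d \<bullet> sgn (Q - P) = d \<bullet> sgn (R - P)" "d \<bullet> sgn (Q - P) > 0"
  shows "bisects_angle d P Q R"
proof -
  have n: "norm (sgn (Q - P)) = 1" "norm (sgn (R - P)) = 1"
    using assms(1) by (auto simp: norm_sgn insert_commute)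
  note ne = sgn_neq_if_not_collinear[OF assms(1)]
  have [simp]: "sgn (sgn v) = sgn v" for v :: "real^2"
    by (cases "v = 0") (simp_all add: sgn_div_norm)
  have sgn2: "vec_angle u (sgn v) = vec_angle u v" "vec_angle (sgn u) v = vec_angle u v"
      "vec_angle u v = vec_angle v u" for u v
    by (simp_all add: vec_angle_eq_arccos_sgn inner_commute)
  have "d \<noteq> 0" using assms(3) by auto
  with vec_angle_half[OF n ne assms(2,3)] vec_angle_half[OF n(2,1) ne[symmetric], of d] assms(2,3)
  show ?thesis unfolding bisects_angle_def by (simp add: sgn2(1,2)) (metis sgn2(3))
qed

text \<open>All bisecting directions are orthogonal to the nonzero vector \<open>e\<close>, hence
  parallel, so the existential quantifier in \<open>excentral_line\<close> describes a single
  line.\<close>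

lemma excentral_line_eq:
  assumes b: "bisects_angle d P Q R" and nc: "\<not> collinear {P, Q, R}"
  shows "excentral_line P Q R = {X. (X - P) \<bullet> d = 0}"
proof -
  define e where "e = sgn (Q - P) - sgn (R - P)"
  have e: "e \<noteq> 0" using sgn_neq_if_not_collinear[OF nc] by (simp add: e_def)
  have perp: "d' \<bullet> e = 0" if "bisects_angle d' P Q R" for d'
    using bisects_angle_imp[OF that] by (simp add: e_def inner_diff_right)
  have "(X - P) \<bullet> d = 0" if d': "bisects_angle d' P Q R" "(X - P) \<bullet> d' = 0" for X d'
  proof -
    have "d' \<noteq> 0" using d' by (simp add: bisects_angle_def)
    have "d$1 * d'$2 = d$2 * d'$1"
      using e perp[OF b] perp[OF d'(1)] by (rule orthogonal_2_parallel)
    then have "d'$1 * ((X - P) \<bullet> d) = 0" "d'$2 * ((X - P) \<bullet> d) = 0"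
      using d'(2) unfolding inner_real_2 by algebra+
    with \<open>d' \<noteq> 0\<close> show ?thesis by (auto simp: vec_eq_iff forall_2)
  qed
  with b show ?thesis by (auto simp: excentral_line_def)
qed

lemma collinear_ell_pt_imp:
  assumes "a > 0" "b > 0" "c1\<^sup>2 + s1\<^sup>2 = 1" "c2\<^sup>2 + s2\<^sup>2 = 1" "c3\<^sup>2 + s3\<^sup>2 = 1"
    and "collinear {ell_pt a b c1 s1, ell_pt a b c2 s2, ell_pt a b c3 s3}"
  shows "\<not> distinct [(c1, s1), (c2, s2), (c3, s3)]"
proof (rule unit_det_zero_imp_eq)
  have "a * b * ((c2 - c1) * (s3 - s1)) = a * b * ((s2 - s1) * (c3 - c1))"
    using assms(6) by (simp add: collinear_real_2 diff_ell_pt mult_ac)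
  with assms(1,2) show "(c2 - c1) * (s3 - s1) = (s2 - s1) * (c3 - c1)" by simp
qed (use assms in auto)

lemma det_ell_pt:
  "det (vector [ell_pt a b c2 s2 - ell_pt a b c1 s1, ell_pt a b c3 s3 - ell_pt a b c1 s1] :: real^2^2)
    = a * b * ((c2 - c1) * (s3 - s1) - (s2 - s1) * (c3 - c1))"
  by (simp add: det_2 diff_ell_pt algebra_simps)

lemma orientation_ell_pt:
  assumes "a > 0" "b > 0"
  shows "orientation (ell_pt a b c1 s1) (ell_pt a b c2 s2) (ell_pt a b c3 s3) =
    sgn ((c2 - c1) * (s3 - s1) - (s2 - s1) * (c3 - c1))"
  using assms by (simp add: orientation_def det_ell_pt sgn_mult)

lemma orientation_swap: "orientation P1 P3 P2 = - orientation P1 P2 P3"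
  by (simp add: orientation_def det_2 sgn_minus[symmetric] mult.commute)

section \<open>The billiard condition\<close>

abbreviation chord :: "real \<Rightarrow> real \<Rightarrow> real \<Rightarrow> real \<Rightarrow> real \<Rightarrow> real \<Rightarrow> real \<Rightarrow> bool" where
  "chord a b R \<equiv> conj_chord (R - a\<^sup>2 + b\<^sup>2) (R + a\<^sup>2 - b\<^sup>2) (R - a\<^sup>2 - b\<^sup>2)"

definition joachimsthal :: "real \<Rightarrow> real \<Rightarrow> real \<Rightarrow> real \<Rightarrow> real \<Rightarrow> real \<Rightarrow> real" where
  "joachimsthal a b c s c' s' =
     (1 - (c * c' + s * s')) / norm (ell_pt a b c s - ell_pt a b c' s')"

lemma joachimsthal_commute: "joachimsthal a b c s c' s' = joachimsthal a b c' s' c s"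
  by (simp add: joachimsthal_def norm_minus_commute mult.commute)

text \<open>The quantity that the reflection law compares at a vertex is symmetric in the two ends
  of the chord, which is why it carries over from one vertex to the next.\<close>

lemma inner_normal_sgn:
  assumes "a > 0" "b > 0" "c\<^sup>2 + s\<^sup>2 = 1"
  shows "- ellipse_normal a b (ell_pt a b c s) \<bullet> sgn (ell_pt a b c' s' - ell_pt a b c s)
    = joachimsthal a b c s c' s'"
proof -
  have e: "ellipse_normal a b (ell_pt a b c s) \<bullet> (ell_pt a b c' s' - ell_pt a b c s)
      = c * c' + s * s' - 1"
    unfolding inner_diff_right using assms
    by (simp add: inner_commute[of "ellipse_normal _ _ _"] inner_ell_pt_normal mult.commute
        flip: power2_eq_square)
  show ?thesis
    unfolding joachimsthal_def sgn_div_norm inner_minus_left inner_scaleR_right e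
      norm_minus_commute[of "ell_pt a b c' s'"]
    by (simp add: divide_inverse algebra_simps)
qed

lemma joachimsthal_pos:
  assumes "a > 0" "b > 0" "c\<^sup>2 + s\<^sup>2 = 1" "c'\<^sup>2 + s'\<^sup>2 = 1" "(c, s) \<noteq> (c', s')"
  shows "joachimsthal a b c s c' s' > 0"
  using unit_inner_less_1[OF assms(3-5)] assms by (simp add: joachimsthal_def ell_pt_eq_iff)

lemma joachimsthal_eq_iff_chord:
  assumes "a > 0" "b > 0" "c\<^sup>2 + s\<^sup>2 = 1" "c'\<^sup>2 + s'\<^sup>2 = 1" "(c, s) \<noteq> (c', s')" "R > 0"
  shows "joachimsthal a b c s c' s' = 1 / sqrt R \<longleftrightarrow> chord a b R c s c' s'"
proof -
  define k where "k = 1 - (c * c' + s * s')"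
  define n where "n = norm (ell_pt a b c s - ell_pt a b c' s')"
  have k: "k > 0" using unit_inner_less_1[OF assms(3-5)] by (simp add: k_def)
  have n: "n > 0" using assms by (simp add: n_def ell_pt_eq_iff)
  have "k / n = 1 / sqrt R \<longleftrightarrow> sqrt R * k = n"
    using n \<open>R > 0\<close> by (auto simp: field_simps)
  also have "\<dots> \<longleftrightarrow> (sqrt R * k)\<^sup>2 = n\<^sup>2"
    using k n \<open>R > 0\<close> by (intro power2_eq_iff_nonneg[symmetric]) auto
  also have "\<dots> \<longleftrightarrow> R * k\<^sup>2 = a\<^sup>2 * (c - c')\<^sup>2 + b\<^sup>2 * (s - s')\<^sup>2"
    using \<open>R > 0\<close> by (simp add: n_def diff_ell_pt norm_ell_pt power_mult_distrib)
  finally show ?thesis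
    unfolding joachimsthal_def k_def n_def chord_iff[OF assms(3-5)] .
qed

lemma bisects_ell_pt_iff:
  assumes "a > 0" "b > 0" and u: "c1\<^sup>2 + s1\<^sup>2 = 1" "c2\<^sup>2 + s2\<^sup>2 = 1" "c3\<^sup>2 + s3\<^sup>2 = 1"
    and d: "distinct [(c1, s1), (c2, s2), (c3, s3)]"
  shows "bisects_angle (- ellipse_normal a b (ell_pt a b c1 s1))
      (ell_pt a b c1 s1) (ell_pt a b c2 s2) (ell_pt a b c3 s3) \<longleftrightarrow>
    joachimsthal a b c1 s1 c2 s2 = joachimsthal a b c1 s1 c3 s3"
proof
  assume "bisects_angle (- ellipse_normal a b (ell_pt a b c1 s1))
      (ell_pt a b c1 s1) (ell_pt a b c2 s2) (ell_pt a b c3 s3)"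
  from bisects_angle_imp[OF this]
  show "joachimsthal a b c1 s1 c2 s2 = joachimsthal a b c1 s1 c3 s3"
    by (simp only: inner_normal_sgn[OF assms(1-3)])
next
  assume "joachimsthal a b c1 s1 c2 s2 = joachimsthal a b c1 s1 c3 s3"
  moreover have "joachimsthal a b c1 s1 c2 s2 > 0"
    using d assms by (intro joachimsthal_pos) auto
  moreover have "\<not> collinear {ell_pt a b c1 s1, ell_pt a b c2 s2, ell_pt a b c3 s3}"
    using collinear_ell_pt_imp[OF assms(1-5)] d by blast
  ultimately show "bisects_angle (- ellipse_normal a b (ell_pt a b c1 s1))
      (ell_pt a b c1 s1) (ell_pt a b c2 s2) (ell_pt a b c3 s3)"
    by (intro bisects_angleI) (simp_all add: inner_normal_sgn[OF assms(1-3)] del: inner_minus_left)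
qed

lemma billiard_orbit3_iff:
  assumes "a > 0" "b > 0" and u: "c1\<^sup>2 + s1\<^sup>2 = 1" "c2\<^sup>2 + s2\<^sup>2 = 1" "c3\<^sup>2 + s3\<^sup>2 = 1"
  shows "billiard_orbit3 a b (ell_pt a b c1 s1) (ell_pt a b c2 s2) (ell_pt a b c3 s3) \<longleftrightarrow>
    distinct [(c1, s1), (c2, s2), (c3, s3)] \<and>
    (\<exists>R>0. chord a b R c1 s1 c2 s2 \<and> chord a b R c2 s2 c3 s3 \<and> chord a b R c3 s3 c1 s1)"
    (is "?orbit \<longleftrightarrow> ?dist \<and> ?ex")
proof (cases ?dist)
  case True
  then have nc: "\<not> collinear {ell_pt a b c1 s1, ell_pt a b c2 s2, ell_pt a b c3 s3}"
    using collinear_ell_pt_imp[OF assms] by blast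
  define J12 J23 J31 where "J12 = joachimsthal a b c1 s1 c2 s2"
    and "J23 = joachimsthal a b c2 s2 c3 s3" and "J31 = joachimsthal a b c3 s3 c1 s1"
  have "?orbit \<longleftrightarrow> J12 = J31 \<and> J23 = J12 \<and> J31 = J23"
  proof -
    have "distinct [(c2, s2), (c3, s3), (c1, s1)]" "distinct [(c3, s3), (c1, s1), (c2, s2)]"
      using True by auto
    then show ?thesis
      using True nc assms bisects_ell_pt_iff[OF assms(1,2,3,4,5)]
        bisects_ell_pt_iff[OF assms(1,2,4,5,3)] bisects_ell_pt_iff[OF assms(1,2,5,3,4)]
      unfolding J12_def J23_def J31_def billiard_orbit3_def
        joachimsthal_commute[of a b c3 s3 c1 s1]
      by (simp add: ell_pt_in_ellipse_iff joachimsthal_commute[of a b c2 s2 c1 s1]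
          joachimsthal_commute[of a b c3 s3 c2 s2] joachimsthal_commute[of a b c3 s3 c1 s1])
  qed
  also have "\<dots> \<longleftrightarrow> (\<exists>R>0. J12 = 1 / sqrt R \<and> J23 = 1 / sqrt R \<and> J31 = 1 / sqrt R)"
  proof
    assume e: "J12 = J31 \<and> J23 = J12 \<and> J31 = J23"
    have "J12 > 0" unfolding J12_def using True assms by (intro joachimsthal_pos) auto
    then have "1 / J12\<^sup>2 > 0 \<and> J12 = 1 / sqrt (1 / J12\<^sup>2)"
      by (simp add: real_sqrt_divide)
    with e show "\<exists>R>0. J12 = 1 / sqrt R \<and> J23 = 1 / sqrt R \<and> J31 = 1 / sqrt R"
      by metis
  qed auto
  also have "\<dots> \<longleftrightarrow> ?ex"
    unfolding J12_def J23_def J31_def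
    using True by (intro ex_cong1 conj_cong refl joachimsthal_eq_iff_chord assms) auto
  finally show ?thesis using True by blast
next
  case False
  then have "collinear {ell_pt a b c1 s1, ell_pt a b c2 s2, ell_pt a b c3 s3}"
    by (auto simp: insert_commute)
  then have "\<not> ?orbit" by (simp add: billiard_orbit3_def)
  with False show ?thesis by blast
qed

text \<open>The bisector at each vertex is the normal, so the perpendicular to it is the
  tangent.\<close>

lemma billiard_orbit3_excentral_line:
  assumes "billiard_orbit3 a b P1 P2 P3"
  shows "excentral_line P1 P2 P3 = ellipse_tangent a b P1"
    "excentral_line P2 P3 P1 = ellipse_tangent a b P2"
    "excentral_line P3 P1 P2 = ellipse_tangent a b P3"
proof -
  have nc: "\<not> collinear {P1, P2, P3}" "\<not> collinear {P2, P3, P1}" "\<not> collinear {P3, P1, P2}"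
    using assms by (simp_all add: billiard_orbit3_def insert_commute)
  have "excentral_line P Q R = ellipse_tangent a b P"
    if "bisects_angle (- ellipse_normal a b P) P Q R" "\<not> collinear {P, Q, R}" for P Q R
    by (simp add: excentral_line_eq[OF that] ellipse_tangent_def)
  with assms nc show "excentral_line P1 P2 P3 = ellipse_tangent a b P1"
    "excentral_line P2 P3 P1 = ellipse_tangent a b P2"
    "excentral_line P3 P1 P2 = ellipse_tangent a b P3"
    by (simp_all add: billiard_orbit3_def)
qed

lemma excentral_triangle_iff:
  assumes "billiard_orbit3 a b P1 P2 P3"
  shows "excentral_triangle P1 P2 P3 A1 A2 A3 \<longleftrightarrow>
     ellipse_tangent a b P2 \<inter> ellipse_tangent a b P3 = {A1} \<and>
     ellipse_tangent a b P3 \<inter> ellipse_tangent a b P1 = {A2} \<and>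
     ellipse_tangent a b P1 \<inter> ellipse_tangent a b P2 = {A3}"
  by (simp add: excentral_triangle_def billiard_orbit3_excentral_line[OF assms])

text \<open>Puts a whole side of the excentral triangle on a tangent once its end points are
  there.\<close>

lemma convex_ellipse_tangent: "convex (ellipse_tangent a b P)"
proof -
  have "ellipse_tangent a b P = {X. ellipse_normal a b P \<bullet> X = ellipse_normal a b P \<bullet> P}"
    by (auto simp: ellipse_tangent_def inner_diff_left inner_commute)
  then show ?thesis by (simp add: convex_hyperplane)
qed

section \<open>The locus\<close>

text \<open>The positive root of Cayley's condition \<open>3 R\<^sup>2 - 2 R (a\<^sup>2 + b\<^sup>2) - (a\<^sup>2 - b\<^sup>2)\<^sup>2 = 0\<close>.\<close>

definition locus_radius2 :: "real \<Rightarrow> real \<Rightarrow> real" where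
  "locus_radius2 a b = (a\<^sup>2 + b\<^sup>2 + 2 * sqrt (a^4 - a\<^sup>2 * b\<^sup>2 + b^4)) / 3"

lemma locus_radius2_pos: "a > 0 \<Longrightarrow> b > 0 \<Longrightarrow> locus_radius2 a b > 0"
  and locus_radius2_eq: "3 * (locus_radius2 a b)\<^sup>2 = 2 * locus_radius2 a b * (a\<^sup>2 + b\<^sup>2) + (a\<^sup>2 - b\<^sup>2)\<^sup>2"
proof -
  define q where "q = sqrt (a^4 - a\<^sup>2 * b\<^sup>2 + b^4)"
  have "a^4 - a\<^sup>2 * b\<^sup>2 + b^4 = (a\<^sup>2 - b\<^sup>2)\<^sup>2 + (a * b)\<^sup>2"
    by algebra
  also have "\<dots> \<ge> 0" by simp
  finally have q: "q \<ge> 0" "q\<^sup>2 = a^4 - a\<^sup>2 * b\<^sup>2 + b^4" by (auto simp: q_def)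
  show "a > 0 \<Longrightarrow> b > 0 \<Longrightarrow> locus_radius2 a b > 0"
    using q(1) by (simp add: locus_radius2_def add_pos_nonneg flip: q_def)
  have r: "3 * locus_radius2 a b = a\<^sup>2 + b\<^sup>2 + 2 * q" by (simp add: locus_radius2_def q_def)
  then have "3 * (3 * (locus_radius2 a b)\<^sup>2) = 3 * (2 * locus_radius2 a b * (a\<^sup>2 + b\<^sup>2) + (a\<^sup>2 - b\<^sup>2)\<^sup>2)"
    using q(2) by algebra
  then show "3 * (locus_radius2 a b)\<^sup>2 = 2 * locus_radius2 a b * (a\<^sup>2 + b\<^sup>2) + (a\<^sup>2 - b\<^sup>2)\<^sup>2"
    by simp
qed

lemma cayley_iff:
  fixes a b R :: real
  shows "(R - a\<^sup>2 + b\<^sup>2) * (R + a\<^sup>2 - b\<^sup>2)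
      + (R - a\<^sup>2 - b\<^sup>2) * ((R - a\<^sup>2 + b\<^sup>2) + (R + a\<^sup>2 - b\<^sup>2)) = 0 \<longleftrightarrow>
    3 * R\<^sup>2 = 2 * R * (a\<^sup>2 + b\<^sup>2) + (a\<^sup>2 - b\<^sup>2)\<^sup>2"
  by (simp add: power2_eq_square algebra_simps)

text \<open>Two different roots would have the product
  \<open>- (a\<^sup>2 - b\<^sup>2)\<^sup>2 / 3\<close>, so they cannot both be positive.\<close>

lemma locus_radius2_unique:
  assumes "a > 0" "b > 0" "R > 0" "3 * R\<^sup>2 = 2 * R * (a\<^sup>2 + b\<^sup>2) + (a\<^sup>2 - b\<^sup>2)\<^sup>2"
  shows "R = locus_radius2 a b"
proof (rule ccontr)
  define S where "S = locus_radius2 a b"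
  have S: "S > 0" "3 * S\<^sup>2 = 2 * S * (a\<^sup>2 + b\<^sup>2) + (a\<^sup>2 - b\<^sup>2)\<^sup>2"
    using assms locus_radius2_pos locus_radius2_eq by (auto simp: S_def)
  assume "R \<noteq> locus_radius2 a b"
  moreover have "(R - S) * (3 * (R + S) - 2 * (a\<^sup>2 + b\<^sup>2)) = 0"
    using assms(4) S(2) by algebra
  ultimately have "2 * (a\<^sup>2 + b\<^sup>2) = 3 * (R + S)" by (simp add: S_def)
  with assms(4) have "3 * (R * S) = - (a\<^sup>2 - b\<^sup>2)\<^sup>2" by algebra
  moreover have "R * S > 0" using assms(3) S(1) by simp
  ultimately show False by (smt (verit) zero_le_power2)
qed

text \<open>Supplies \<alpha> + \<gamma> > 0 and \<beta> + \<gamma> > 0, since these sums are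
  \<open>2 * (R - a\<^sup>2)\<close> and \<open>2 * (R - b\<^sup>2)\<close>.\<close>

lemma locus_radius2_greater:
  assumes "a > 0" "b > 0"
  shows "locus_radius2 a b > a\<^sup>2" "locus_radius2 a b > b\<^sup>2"
proof -
  define R where "R = locus_radius2 a b"
  have R: "R > 0" "3 * R\<^sup>2 = 2 * R * (a\<^sup>2 + b\<^sup>2) + (a\<^sup>2 - b\<^sup>2)\<^sup>2"
    using assms locus_radius2_pos locus_radius2_eq by (auto simp: R_def)
  have "R * (3 * R - 2 * (a\<^sup>2 + b\<^sup>2)) = (a\<^sup>2 - b\<^sup>2)\<^sup>2"
    using R(2) by algebra
  then have nn: "3 * R - 2 * (a\<^sup>2 + b\<^sup>2) \<ge> 0"
    using R(1) by (metis zero_le_mult_iff zero_le_power2 not_less)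
  \<comment> \<open>The quadratic that vanishes at \<open>R\<close> takes the value
    \<open>- (b\<^sup>2)\<^sup>2\<close> at \<open>a\<^sup>2\<close> and
    \<open>- (a\<^sup>2)\<^sup>2\<close> at \<open>b\<^sup>2\<close>; the left sides are the
    factored differences.\<close>
  have "(R - a\<^sup>2) * (3 * (a\<^sup>2 + R) - 2 * (a\<^sup>2 + b\<^sup>2)) = (b\<^sup>2)\<^sup>2"
      "(R - b\<^sup>2) * (3 * (b\<^sup>2 + R) - 2 * (a\<^sup>2 + b\<^sup>2)) = (a\<^sup>2)\<^sup>2"
    using R(2) by algebra+
  moreover have "(b\<^sup>2)\<^sup>2 > 0" "(a\<^sup>2)\<^sup>2 > 0" using assms by simp_all
  moreover have "3 * (a\<^sup>2 + R) - 2 * (a\<^sup>2 + b\<^sup>2) \<ge> 0" "3 * (b\<^sup>2 + R) - 2 * (a\<^sup>2 + b\<^sup>2) \<ge> 0"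
    using nn zero_le_power2[of a] zero_le_power2[of b] by argo+
  ultimately show "R > a\<^sup>2" "R > b\<^sup>2"
    by (smt (verit) mult_nonpos_nonneg)+
qed

section \<open>Intersection of the tangents at \<open>- P\<^sub>1\<close> and
  \<open>P\<^sub>2\<close>\<close>

text \<open>The vector \<open>p\<^sub>2 - p\<^sub>1\<close> satisfies both tangent equations scaled
  by \<open>k\<close>, and independence makes the solution unique.\<close>

lemma tangents_meet:
  fixes c1 s1 c2 s2 x y :: real
  assumes u: "c1\<^sup>2 + s1\<^sup>2 = 1" "c2\<^sup>2 + s2\<^sup>2 = 1" and D: "c1 * s2 \<noteq> s1 * c2"
    and q: "x * c1 + y * s1 = - 1" "x * c2 + y * s2 = 1"
  defines "k \<equiv> 1 - (c1 * c2 + s1 * s2)"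
  shows "k * x = c2 - c1" "k * y = s2 - s1"
proof -
  have "(k * x) * c1 + (k * y) * s1 = (c2 - c1) * c1 + (s2 - s1) * s1"
    "(k * x) * c2 + (k * y) * s2 = (c2 - c1) * c2 + (s2 - s1) * s2"
    unfolding k_def using u q by algebra+
  from linear_2_unique[OF D this] show "k * x = c2 - c1" "k * y = s2 - s1" by simp_all
qed

lemma tangents_meet_norm_iff_chord:
  assumes u: "c1\<^sup>2 + s1\<^sup>2 = 1" "c2\<^sup>2 + s2\<^sup>2 = 1" and D: "c1 * s2 \<noteq> s1 * c2"
    and q: "x * c1 + y * s1 = - 1" "x * c2 + y * s2 = 1"
  shows "(norm (ell_pt a b x y))\<^sup>2 = R \<longleftrightarrow> chord a b R c1 s1 c2 s2"
proof -
  define k where "k = 1 - (c1 * c2 + s1 * s2)"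
  have ne: "(c1, s1) \<noteq> (c2, s2)" using D by (auto simp: mult.commute)
  have k: "k > 0" using unit_inner_less_1[OF u ne] by (simp add: k_def)
  note m = tangents_meet[OF u D q, folded k_def]
  have "(norm (ell_pt a b x y))\<^sup>2 * k\<^sup>2 = a\<^sup>2 * (k * x)\<^sup>2 + b\<^sup>2 * (k * y)\<^sup>2"
    by (simp add: norm_ell_pt power_mult_distrib algebra_simps)
  also have "\<dots> = a\<^sup>2 * (c1 - c2)\<^sup>2 + b\<^sup>2 * (s1 - s2)\<^sup>2"
    unfolding m by (simp add: power2_commute)
  finally have n: "(norm (ell_pt a b x y))\<^sup>2 * k\<^sup>2 = a\<^sup>2 * (c1 - c2)\<^sup>2 + b\<^sup>2 * (s1 - s2)\<^sup>2" .
  have "(norm (ell_pt a b x y))\<^sup>2 = R \<longleftrightarrow> R * k\<^sup>2 = (norm (ell_pt a b x y))\<^sup>2 * k\<^sup>2"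
    using k by auto
  also have "\<dots> \<longleftrightarrow> chord a b R c1 s1 c2 s2"
    unfolding n unfolding k_def by (rule chord_iff[OF u ne])
  finally show ?thesis .
qed

text \<open>Tangents at antipodal points are disjoint. Thus the existence of the excentral triangle
  yields the non-antipodality required by \<open>conj_triangle_cayley\<close>.\<close>

lemma not_antipodal_if_tangents_meet:
  assumes "a > 0" "b > 0" "c1\<^sup>2 + s1\<^sup>2 = 1" "c2\<^sup>2 + s2\<^sup>2 = 1"
    and "ellipse_tangent a b (ell_pt a b c1 s1) \<inter> ellipse_tangent a b (ell_pt a b c2 s2) = {A}"
  shows "(c1, s1) \<noteq> (- c2, - s2)"
proof
  assume e: "(c1, s1) = (- c2, - s2)"
  obtain x y where "A = ell_pt a b x y" using ell_pt_surj[OF assms(1,2)] .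
  with assms have "x * c1 + y * s1 = 1" "x * c2 + y * s2 = 1"
    using ell_pt_in_tangent_iff[OF assms(1-3)] ell_pt_in_tangent_iff[OF assms(1,2,4)] by blast+
  with e show False by simp
qed

lemma unit_parallel_imp:
  fixes c s c' s' :: real
  assumes "c\<^sup>2 + s\<^sup>2 = 1" "c'\<^sup>2 + s'\<^sup>2 = 1" "c * s' = s * c'"
  shows "(c, s) = (c', s') \<or> (c, s) = (- c', - s')"
proof -
  define p where "p = c * c' + s * s'"
  have "p\<^sup>2 + (c * s' - s * c')\<^sup>2 = (c\<^sup>2 + s\<^sup>2) * (c'\<^sup>2 + s'\<^sup>2)" unfolding p_def by algebra
  then have "p = 1 \<or> p = -1" using assms by (simp add: power2_eq_1_iff)
  moreover have "c = p * c'" "s = p * s'" unfolding p_def using assms(2,3) by algebra+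
  ultimately show ?thesis by auto
qed

lemma ellipse_obtain:
  assumes "a > 0" "b > 0" "P \<in> ellipse a b"
  obtains c s where "P = ell_pt a b c s" "c\<^sup>2 + s\<^sup>2 = 1"
  using assms by (metis ell_pt_surj ell_pt_in_ellipse_iff)

section \<open>Inclusion of the locus in the circle\<close>

lemma locus_Q1_subset:
  assumes "a > 0" "b > 0" and Q: "Q \<in> locus_Q1 a b s"
  shows "(norm Q)\<^sup>2 = locus_radius2 a b"
proof -
  note ab = assms(1,2)
  from Q obtain P1 P2 P3 A1 A2 A3 where o: "billiard_orbit3 a b P1 P2 P3"
    and t: "excentral_triangle P1 P2 P3 A1 A2 A3"
    and Q1: "Q \<in> ellipse_tangent a b (- P1)" "Q \<in> closed_segment A3 A1"
    unfolding locus_Q1_def by blast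
  from o have "P1 \<in> ellipse a b" "P2 \<in> ellipse a b" "P3 \<in> ellipse a b"
    by (simp_all add: billiard_orbit3_def)
  then obtain c1 s1 c2 s2 c3 s3 where P: "P1 = ell_pt a b c1 s1" "P2 = ell_pt a b c2 s2"
      "P3 = ell_pt a b c3 s3"
    and u: "c1\<^sup>2 + s1\<^sup>2 = 1" "c2\<^sup>2 + s2\<^sup>2 = 1" "c3\<^sup>2 + s3\<^sup>2 = 1"
    by (metis ellipse_obtain[OF ab])
  obtain R where d: "distinct [(c1, s1), (c2, s2), (c3, s3)]" and "R > 0"
    and c: "chord a b R c1 s1 c2 s2" "chord a b R c2 s2 c3 s3" "chord a b R c3 s3 c1 s1"
    using o unfolding P billiard_orbit3_iff[OF ab u] by blast
  note T = t[unfolded excentral_triangle_iff[OF o]]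
  have n: "(c1, s1) \<noteq> (- c2, - s2)" "(c2, s2) \<noteq> (- c3, - s3)" "(c3, s3) \<noteq> (- c1, - s1)"
    using T unfolding P by (metis not_antipodal_if_tangents_meet[OF ab] u)+
  have "R = locus_radius2 a b"
    using \<open>R > 0\<close>
    by (intro locus_radius2_unique[OF ab] cayley_iff[THEN iffD1] conj_triangle_cayley[OF u d n c])
      simp_all
  moreover have "(norm Q)\<^sup>2 = R"
  proof -
    \<comment> \<open>The side from \<open>A3\<close> to \<open>A1\<close> lies on the tangent at
      \<open>P2\<close>, so \<open>Q\<close> is the meeting point of the tangents at
      \<open>- P1\<close> and \<open>P2\<close>.\<close>
    have "A3 \<in> ellipse_tangent a b P2" "A1 \<in> ellipse_tangent a b P2" using T by blast+
    with Q1(2) have Q2: "Q \<in> ellipse_tangent a b P2"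
      using closed_segment_subset[OF _ _ convex_ellipse_tangent] by blast
    obtain x y where xy: "Q = ell_pt a b x y" using ell_pt_surj[OF ab] .
    have q: "x * c1 + y * s1 = - 1" "x * c2 + y * s2 = 1"
      using Q1(1) Q2 u ab unfolding xy P by (simp_all add: uminus_ell_pt ell_pt_in_tangent_iff)
    have "c1 * s2 \<noteq> s1 * c2" using unit_parallel_imp[OF u(1,2)] d n(1) by auto
    from tangents_meet_norm_iff_chord[OF u(1,2) this q] c(1) show ?thesis by (simp add: xy)
  qed
  ultimately show ?thesis by simp
qed

section \<open>Inclusion of the circle in the locus\<close>

lemma tangents_inter_eq:
  assumes "a > 0" "b > 0" "c1\<^sup>2 + s1\<^sup>2 = 1" "c2\<^sup>2 + s2\<^sup>2 = 1" "c1 * s2 \<noteq> s1 * c2"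
    and "x * c1 + y * s1 = 1" "x * c2 + y * s2 = 1"
  shows "ellipse_tangent a b (ell_pt a b c1 s1) \<inter> ellipse_tangent a b (ell_pt a b c2 s2)
    = {ell_pt a b x y}"
proof -
  have "X = ell_pt a b x y" if X: "X \<in> ellipse_tangent a b (ell_pt a b c1 s1)"
    "X \<in> ellipse_tangent a b (ell_pt a b c2 s2)" for X
  proof -
    obtain x' y' where X': "X = ell_pt a b x' y'" using ell_pt_surj[OF assms(1,2)] .
    have "x' * c1 + y' * s1 = 1" "x' * c2 + y' * s2 = 1"
      using X assms by (simp_all add: X' ell_pt_in_tangent_iff)
    then show ?thesis using linear_2_unique[OF assms(5), of x' y' x y] assms by (simp add: X')
  qed
  then show ?thesis using assms by (auto simp: ell_pt_in_tangent_iff)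
qed

text \<open>The delicate point is that \<open>Q\<close> lies on the closed side of the excentral
  triangle and not merely on its line; the sign conditions on \<alpha>, \<beta>, \<gamma> ensure
  this.\<close>

lemma tangents_meet_in_locus_Q1:
  fixes c1 s1 c2 s2 c3 s3 :: real
  assumes ab: "a > 0" "b > 0"
    and u: "c1\<^sup>2 + s1\<^sup>2 = 1" "c2\<^sup>2 + s2\<^sup>2 = 1" "c3\<^sup>2 + s3\<^sup>2 = 1"
    and c: "chord a b R c1 s1 c2 s2" "chord a b R c2 s2 c3 s3" "chord a b R c3 s3 c1 s1"
    and R: "R > a\<^sup>2" "R > b\<^sup>2" "R < a\<^sup>2 + b\<^sup>2"
    and q: "x * c1 + y * s1 = - 1" "x * c2 + y * s2 = 1"
  shows "ell_pt a b x y \<in> locus_Q1 a b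
    (orientation (ell_pt a b c1 s1) (ell_pt a b c2 s2) (ell_pt a b c3 s3))"
proof -
  define \<alpha> \<beta> \<gamma> where "\<alpha> = R - a\<^sup>2 + b\<^sup>2" and "\<beta> = R + a\<^sup>2 - b\<^sup>2" and "\<gamma> = R - a\<^sup>2 - b\<^sup>2"
  note c' = c[folded \<alpha>_def \<beta>_def \<gamma>_def]
  have pos: "\<gamma> < 0" "\<alpha> + \<gamma> > 0" "\<beta> + \<gamma> > 0" using R by (auto simp: \<alpha>_def \<beta>_def \<gamma>_def)
  have D: "c1 * s2 \<noteq> s1 * c2" "c2 * s3 \<noteq> s2 * c3" "c3 * s1 \<noteq> s3 * c1"
    using conj_chord_indep[OF _ _ _ pos] u c' by blast+
  then have d: "distinct [(c1, s1), (c2, s2), (c3, s3)]" by (auto simp: mult.commute)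
  have "R > 0" using R(1) ab by (smt (verit) zero_le_power2)
  with d c have o: "billiard_orbit3 a b (ell_pt a b c1 s1) (ell_pt a b c2 s2) (ell_pt a b c3 s3)"
    unfolding billiard_orbit3_iff[OF ab u] by blast
  \<comment> \<open>The vertex opposite the side through \<open>P\<^sub>i\<close> is the pole of the chord \<open>P\<^sub>j P\<^sub>k\<close>.\<close>
  define A where "A c s = ell_pt a b (\<alpha> * c / \<gamma>) (\<beta> * s / \<gamma>)" for c s
  have A: "\<alpha> * c / \<gamma> * c' + \<beta> * s / \<gamma> * s' = 1" "\<alpha> * c' / \<gamma> * c + \<beta> * s' / \<gamma> * s = 1"
    if "conj_chord \<alpha> \<beta> \<gamma> c s c' s'" for c s c' s'
    using that pos(1) by (simp_all add: conj_chord_def mult_ac flip: add_divide_distrib)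
  have t: "excentral_triangle (ell_pt a b c1 s1) (ell_pt a b c2 s2) (ell_pt a b c3 s3)
      (A c1 s1) (A c2 s2) (A c3 s3)"
    unfolding excentral_triangle_iff[OF o] A_def
    using A c' by (intro conjI tangents_inter_eq ab u D) auto
  define \<kappa> where "\<kappa> = - (\<alpha> * c1\<^sup>2 + \<beta> * s1\<^sup>2) / \<gamma>"
  have "\<alpha> * c1\<^sup>2 + \<beta> * s1\<^sup>2 + \<gamma> = (\<alpha> + \<gamma>) * c1\<^sup>2 + (\<beta> + \<gamma>) * s1\<^sup>2"
    using u(1) by algebra
  also have "\<dots> \<ge> 0" using pos by simp
  finally have \<kappa>: "\<kappa> \<ge> 1" using pos(1) by (simp add: \<kappa>_def field_simps)
  \<comment> \<open>On the side through \<open>P\<^sub>2\<close> the functional \<open>p\<^sub>1 \<bullet> _\<close> runs from \<open>1\<close> at \<open>A\<^sub>3\<close> to \<open>- \<kappa> \<le> - 1\<close> at \<open>A\<^sub>1\<close>;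
    the weight \<open>w\<close> marks where it equals \<open>- 1\<close>.\<close>
  define w where "w = 2 / (1 + \<kappa>)"
  have w: "0 \<le> w" "w \<le> 1" "w * (1 + \<kappa>) = 2" using \<kappa> by (simp_all add: w_def field_simps)
  define x' y' where "x' = (1 - w) * (\<alpha> * c3 / \<gamma>) + w * (\<alpha> * c1 / \<gamma>)"
    and "y' = (1 - w) * (\<beta> * s3 / \<gamma>) + w * (\<beta> * s1 / \<gamma>)"
  have "x' * c1 + y' * s1 = (1 - w) * (\<alpha> * c3 / \<gamma> * c1 + \<beta> * s3 / \<gamma> * s1)
      + w * (\<alpha> * c1 / \<gamma> * c1 + \<beta> * s1 / \<gamma> * s1)"
    unfolding x'_def y'_def by algebra
  also have "\<alpha> * c1 / \<gamma> * c1 + \<beta> * s1 / \<gamma> * s1 = - \<kappa>"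
    by (simp add: \<kappa>_def power2_eq_square mult_ac add_divide_distrib diff_divide_distrib)
  also have "(1 - w) * (\<alpha> * c3 / \<gamma> * c1 + \<beta> * s3 / \<gamma> * s1) + w * - \<kappa> = - 1"
    unfolding A(1)[OF c'(3)] using w(3) by (simp add: algebra_simps)
  finally have q1: "x' * c1 + y' * s1 = - 1" .
  have "x' * c2 + y' * s2 = (1 - w) * (\<alpha> * c3 / \<gamma> * c2 + \<beta> * s3 / \<gamma> * s2)
      + w * (\<alpha> * c1 / \<gamma> * c2 + \<beta> * s1 / \<gamma> * s2)"
    unfolding x'_def y'_def by algebra
  also have "\<dots> = 1" unfolding A(1)[OF c'(1)] A(2)[OF c'(2)] by simp
  finally have q2: "x' * c2 + y' * s2 = 1" .
  have "x = x'" "y = y'" using linear_2_unique[OF D(1), of x y x' y'] q q1 q2 by simp_all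
  then have "ell_pt a b x y = (1 - w) *\<^sub>R A c3 s3 + w *\<^sub>R A c1 s1"
    by (simp add: A_def scale_ell_pt add_ell_pt x'_def y'_def)
  then have "ell_pt a b x y \<in> closed_segment (A c3 s3) (A c1 s1)"
    using w by (auto simp: closed_segment_def)
  moreover have "ell_pt a b x y \<in> ellipse_tangent a b (- ell_pt a b c1 s1)"
    using ab u(1) q(1) by (simp add: uminus_ell_pt ell_pt_in_tangent_iff)
  ultimately show ?thesis using o t unfolding locus_Q1_def by blast
qed

lemma tangent_points:
  fixes x y :: real
  assumes "x\<^sup>2 + y\<^sup>2 > 1"
  obtains c1 s1 c2 s2 where "c1\<^sup>2 + s1\<^sup>2 = 1" "c2\<^sup>2 + s2\<^sup>2 = 1" "c1 * s2 \<noteq> s1 * c2"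
    "x * c1 + y * s1 = - 1" "x * c2 + y * s2 = 1"
proof -
  define N h where "N = x\<^sup>2 + y\<^sup>2" and "h = sqrt (N - 1)"
  have N: "N > 1" using assms by (simp add: N_def)
  then have h: "h\<^sup>2 = N - 1" "h > 0" by (simp_all add: h_def)
  \<comment> \<open>The points of tangency from (x, y) are
    \<open>((x, y) \<plusminus> h (- y, x)) / N\<close>. The plus sign gives
    \<open>p\<^sub>2\<close>, the minus sign \<open>- p\<^sub>1\<close>.\<close>
  define c1 s1 c2 s2 where "c1 = (- x - h * y) / N" and "s1 = (- y + h * x) / N"
    and "c2 = (x - h * y) / N" and "s2 = (y + h * x) / N"
  have p: "N * c1 = - x - h * y" "N * s1 = - y + h * x" "N * c2 = x - h * y" "N * s2 = y + h * x"
    using N by (simp_all add: c1_def s1_def c2_def s2_def)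
  show ?thesis
  proof
    have "N * N * (c1\<^sup>2 + s1\<^sup>2) = (N * c1)\<^sup>2 + (N * s1)\<^sup>2" by algebra
    also have "\<dots> = N * N" unfolding p using h(1) N_def by algebra
    finally show "c1\<^sup>2 + s1\<^sup>2 = 1" using N by simp
    have "N * N * (c2\<^sup>2 + s2\<^sup>2) = (N * c2)\<^sup>2 + (N * s2)\<^sup>2" by algebra
    also have "\<dots> = N * N" unfolding p using h(1) N_def by algebra
    finally show "c2\<^sup>2 + s2\<^sup>2 = 1" using N by simp
    have "N * N * (c1 * s2 - s1 * c2) = (N * c1) * (N * s2) - (N * s1) * (N * c2)" by algebra
    also have "\<dots> = - 2 * h * N" unfolding p unfolding N_def by algebra
    finally show "c1 * s2 \<noteq> s1 * c2" using N h(2) by auto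
    have "N * (x * c1 + y * s1) = x * (N * c1) + y * (N * s1)" by algebra
    also have "\<dots> = N * (- 1)" unfolding p unfolding N_def by algebra
    finally show "x * c1 + y * s1 = - 1" using N by (subst (asm) mult_left_cancel) auto
    have "N * (x * c2 + y * s2) = x * (N * c2) + y * (N * s2)" by algebra
    also have "\<dots> = N * 1" unfolding p unfolding N_def by algebra
    finally show "x * c2 + y * s2 = 1" using N by simp
  qed
qed

text \<open>If \<gamma> were nonnegative, the left side of Cayley's condition would be positive,
  because \<alpha> and \<beta> are.\<close>

lemma locus_radius2_less:
  assumes "a > 0" "b > 0"
  shows "locus_radius2 a b < a\<^sup>2 + b\<^sup>2"
proof (rule ccontr)
  define R where "R = locus_radius2 a b"
  assume "\<not> locus_radius2 a b < a\<^sup>2 + b\<^sup>2"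
  then have "R - a\<^sup>2 - b\<^sup>2 \<ge> 0" by (simp add: R_def)
  moreover have "R - a\<^sup>2 + b\<^sup>2 > 0" "R + a\<^sup>2 - b\<^sup>2 > 0"
    using locus_radius2_greater[OF assms] unfolding R_def by (smt (verit) zero_le_power2)+
  moreover have "(R - a\<^sup>2 + b\<^sup>2) * (R + a\<^sup>2 - b\<^sup>2)
      + (R - a\<^sup>2 - b\<^sup>2) * ((R - a\<^sup>2 + b\<^sup>2) + (R + a\<^sup>2 - b\<^sup>2)) = 0"
    unfolding cayley_iff by (simp add: R_def locus_radius2_eq)
  ultimately show False by (smt (verit) mult_nonneg_nonneg mult_pos_pos)
qed

lemma locus_Q1_superset:
  assumes ab: "a > 0" "b > 0" and s: "s \<in> {1, -1}" and Q: "(norm Q)\<^sup>2 = locus_radius2 a b"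
  shows "Q \<in> locus_Q1 a b s"
proof -
  define R where "R = locus_radius2 a b"
  note R = locus_radius2_greater[OF ab, folded R_def] locus_radius2_less[OF ab, folded R_def]
  obtain x y where xy: "Q = ell_pt a b x y" using ell_pt_surj[OF ab] .
  \<comment> \<open>The circle lies outside the ellipse because \<open>R\<close> exceeds both
    squared semi-axes, so two tangents from \<open>Q\<close> exist.\<close>
  have "x\<^sup>2 + y\<^sup>2 > 1"
  proof (rule ccontr)
    assume *: "\<not> x\<^sup>2 + y\<^sup>2 > 1"
    have e: "a\<^sup>2 * x\<^sup>2 + b\<^sup>2 * y\<^sup>2 = R" using Q by (simp add: xy norm_ell_pt R_def)
    have "R > 0" using ab by (simp add: R_def locus_radius2_pos)
    have "(R - a\<^sup>2) * x\<^sup>2 + (R - b\<^sup>2) * y\<^sup>2 = R * (x\<^sup>2 + y\<^sup>2 - 1)"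
      using e by (simp add: algebra_simps)
    also have "\<dots> \<le> 0" using * \<open>R > 0\<close> by (simp add: mult_nonneg_nonpos)
    finally have "(R - a\<^sup>2) * x\<^sup>2 + (R - b\<^sup>2) * y\<^sup>2 \<le> 0" .
    moreover have "x \<noteq> 0 \<or> y \<noteq> 0" using e \<open>R > 0\<close> by auto
    ultimately show False using R
      by (smt (verit) mult_nonneg_nonneg mult_pos_pos zero_less_power2 zero_le_power2)
  qed
  then obtain c1 s1 c2 s2 where u: "c1\<^sup>2 + s1\<^sup>2 = 1" "c2\<^sup>2 + s2\<^sup>2 = 1"
    and D: "c1 * s2 \<noteq> s1 * c2" and q: "x * c1 + y * s1 = - 1" "x * c2 + y * s2 = 1"
    by (rule tangent_points)
  have c12: "chord a b R c1 s1 c2 s2"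
    using tangents_meet_norm_iff_chord[OF u D q] Q by (simp add: R_def xy)
  have "(R - a\<^sup>2 + b\<^sup>2) * (R + a\<^sup>2 - b\<^sup>2)
      + (R - a\<^sup>2 - b\<^sup>2) * ((R - a\<^sup>2 + b\<^sup>2) + (R + a\<^sup>2 - b\<^sup>2)) = 0"
    unfolding cayley_iff by (simp add: R_def locus_radius2_eq)
  then obtain c3 s3 where u3: "c3\<^sup>2 + s3\<^sup>2 = 1" and ne: "(c2, s2) \<noteq> (c3, s3)"
    and c: "chord a b R c2 s2 c3 s3" "chord a b R c3 s3 c1 s1"
    using R by (elim conj_triangle_close[OF _ u c12]) auto
  note indep12 = D
  define D where "D = (c2 - c1) * (s3 - s1) - (s2 - s1) * (c3 - c1)"
  have in1: "Q \<in> locus_Q1 a b (sgn D)"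
    using tangents_meet_in_locus_Q1[OF ab u u3 c12 c R q]
    by (simp add: orientation_ell_pt ab xy D_def)
  \<comment> \<open>With \<open>- P\<^sub>2\<close> as chosen vertex and \<open>- P\<^sub>1\<close>
    following it, the two tangents are again those at \<open>P\<^sub>2\<close> and
    \<open>- P\<^sub>1\<close>, so the point is still \<open>Q\<close>.\<close>
  have "Q \<in> locus_Q1 a b (orientation (ell_pt a b (- c2) (- s2)) (ell_pt a b (- c1) (- s1))
      (ell_pt a b (- c3) (- s3)))"
    unfolding xy using u u3 c12 c R q
    by (intro tangents_meet_in_locus_Q1[where R = R] ab)
      (auto simp: conj_chord_def mult.commute)
  moreover have "(- c1 - - c2) * (- s3 - - s2) - (- s1 - - s2) * (- c3 - - c2) = - D"
    unfolding D_def by algebra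
  ultimately have in2: "Q \<in> locus_Q1 a b (- sgn D)"
    by (simp only: orientation_ell_pt[OF ab] sgn_minus)
  \<comment> \<open>A nonzero \<open>D\<close> is needed for \<open>sgn D\<close> and
    \<open>- sgn D\<close> to exhaust both orientations.\<close>
  have "D \<noteq> 0"
  proof
    assume "D = 0"
    then have "\<not> distinct [(c1, s1), (c2, s2), (c3, s3)]"
      using u u3 by (intro unit_det_zero_imp_eq) (auto simp: D_def)
    moreover have "(c1, s1) \<noteq> (c2, s2)" using indep12 by (auto simp: mult.commute)
    moreover have "c3 * s1 \<noteq> s3 * c1"
      using c(2) R by (intro conj_chord_indep[OF u3 u(1)]) auto
    ultimately show False using ne by (auto simp: mult.commute)
  qed
  then have "s = sgn D \<or> s = - sgn D" using s by (auto simp: sgn_if)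
  with in1 in2 show ?thesis by blast
qed

section \<open>Exchange of the following and the preceding vertex\<close>

lemma billiard_orbit3_swap:
  "billiard_orbit3 a b P1 P3 P2 \<longleftrightarrow> billiard_orbit3 a b P1 P2 P3"
  unfolding billiard_orbit3_def bisects_angle_def vec_angle_def
  by (auto simp: insert_commute inner_commute mult.commute)

lemma excentral_triangle_swap:
  assumes "billiard_orbit3 a b P1 P2 P3"
  shows "excentral_triangle P1 P3 P2 A1 A3 A2 \<longleftrightarrow> excentral_triangle P1 P2 P3 A1 A2 A3"
  using excentral_triangle_iff[OF assms] excentral_triangle_iff[of a b P1 P3 P2 A1 A3 A2] assms
  by (auto simp: billiard_orbit3_swap Int_commute)

text \<open>Exchanging the second and third vertices reverses the orientation and turns the side
  through the preceding vertex into the side through the following one.\<close>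

lemma locus_Q2_eq: "locus_Q2 a b s = locus_Q1 a b (- s)"
proof -
  have "Q \<in> locus_Q2 a b s \<longleftrightarrow> Q \<in> locus_Q1 a b (- s)" for Q
    unfolding locus_Q1_def locus_Q2_def mem_Collect_eq
    by (metis (no_types, lifting) billiard_orbit3_swap excentral_triangle_swap orientation_swap
        minus_minus closed_segment_commute)
  then show ?thesis by blast
qed

lemma locus_Q1_eq:
  assumes "a > 0" "b > 0" "s \<in> {1, -1}"
  shows "locus_Q1 a b s = sphere 0 (sqrt (locus_radius2 a b))"
proof -
  have "norm Q = sqrt (locus_radius2 a b) \<longleftrightarrow> (norm Q)\<^sup>2 = locus_radius2 a b" for Q :: "real^2"
    using real_sqrt_eq_iff[of "(norm Q)\<^sup>2" "locus_radius2 a b"] by simp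
  moreover have "Q \<in> locus_Q1 a b s \<longleftrightarrow> (norm Q)\<^sup>2 = locus_radius2 a b" for Q
    using locus_Q1_subset[OF assms(1,2)] locus_Q1_superset[OF assms] by blast
  ultimately show ?thesis by (simp add: set_eq_iff)
qed

theorem theorem7:
  fixes a b s :: real
  assumes "a > 0" and "b > 0"
    and "s \<in> {1, -1}"
  shows "(\<exists>r>0. locus_Q1 a b s = sphere 0 r) \<and> (\<exists>r>0. locus_Q2 a b s = sphere 0 r)"
proof -
  have "- s \<in> {1, -1}" using assms(3) by auto
  then show ?thesis
    using locus_Q1_eq[OF assms(1,2)] assms(3) locus_radius2_pos[OF assms(1,2)]
    unfolding locus_Q2_eq by (metis real_sqrt_gt_zero)
qed

end
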